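(* Let $Y$ be a non-negative integer-valued random variable with $\mathrm{Var}[Y]\le\mathbb{E}[Y]<\infty$. Then, for any positive integer $N$, $$\mathrm{Var}[Y_N]<\mathbb{E}[Y_N].$$ In particular, $\mathrm{Var}[Y_N]<\mathbb{E}[Y_N]$ if $Y$ is a Poisson random variable.
   Context: For a non-negative integer-valued random variable $Y$ and a positive integer $N$, $Y_N$ denotes the truncated random variable $Y_N=\min(Y,N)$.
   Formalization: The general claim is false as stated (Y uniform on {0,2}, N=2 gives equality); it is proved for each N under the extra condition that Var[Y]<E[Y] or P(Y>N)>0, which excludes only cases of equality. The Poisson claim is proved for every positive rate. *)

theory Defs
  imports "HOL-Probability.Probability"
begin

(* Var[Y] <= E[Y] alone only gives Var[Y_N] <= E[Y_N]: if Y <= N almost surely, then Y_N = Y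
   almost surely, so an equality Var[Y] = E[Y] is inherited by Y_N. For example, Y = 0, or Y
   uniform on {0, 2}, where E[Y_N] = Var[Y_N] = 1 for all N >= 2. This is the only case in which
   strictness fails; the disjunction "Var[Y] < E[Y] or P(Y > N) > 0" excludes exactly this case. *)
definition trunc_rv :: "('a \<Rightarrow> nat) \<Rightarrow> nat \<Rightarrow> 'a \<Rightarrow> nat" where
  "trunc_rv Y N = (\<lambda>\<omega>. min (Y \<omega>) N)"

(* Bochner integrals of non-integrable functions are 0, so finiteness of E[Y] and Var[Y] must be
   assumed separately through integrability of Y and of its square. *)
definition expect :: "'a measure \<Rightarrow> ('a \<Rightarrow> nat) \<Rightarrow> real" where
  "expect M Y = prob_space.expectation M (\<lambda>\<omega>. real (Y \<omega>))"

definition var :: "'a measure \<Rightarrow> ('a \<Rightarrow> nat) \<Rightarrow> real" where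
  "var M Y = prob_space.variance M (\<lambda>\<omega>. real (Y \<omega>))"

end

theory Submission
  imports Defs
begin

text \<open>
  Write \<open>X = min Y b\<close> for the variable truncated at \<open>b \<ge> 1\<close>, and \<open>a = b - E X\<close> for the mean
  shortfall \<open>E (b - Y)\<^sup>+\<close>.  There are two cases, depending on the size of \<open>a\<close>.

  If \<open>a < 1\<close>, the claim holds for every variable with values in \<open>[0, b]\<close>, whatever \<open>Y\<close> is: among
  those with mean \<open>b - a\<close> the largest variance is that of a variable with values in \<open>{0, b}\<close>,
  namely \<open>a * (b - a)\<close>, and this is less than the mean \<open>b - a\<close>.

  If \<open>a \<ge> 1\<close>, the overshoot \<open>Z = Y - X\<close> is nonzero only where \<open>X = b\<close>, so its covariance with \<open>X\<close>
  is \<open>a * E Z\<close> and \<open>Var Y = Var X + Var Z + 2 * a * E Z\<close>.  Hence \<open>Var Y - E Y\<close> exceeds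
  \<open>Var X - E X\<close> by \<open>Var Z + (2 * a - 1) * E Z \<ge> E Z \<ge> 0\<close>.  So in this case truncation cannot
  increase \<open>Var - E\<close>, and it decreases it strictly as soon as \<open>E Z > 0\<close>, that is, \<open>P (Y > b) > 0\<close>.

  The Poisson distribution satisfies the hypotheses because its mean and its variance coincide and
  its support is unbounded; its moments come from the Stein--Chen identity
  \<open>E (Y * g Y) = rate * E (g (Y + 1))\<close>.
\<close>

section \<open>Truncation of square-integrable random variables\<close>

context prob_space
begin

text \<open>
  Integrating \<open>X\<^sup>2 \<le> b * X\<close> bounds the second moment by \<open>b * E X\<close>; equality holds exactly for
  variables with values in \<open>{0, b}\<close> almost surely.
\<close>

lemma variance_le_bounded:
  fixes X :: "'a \<Rightarrow> real"
  assumes [measurable]: "X \<in> borel_measurable M"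
    and bounds: "\<And>\<omega>. 0 \<le> X \<omega>" "\<And>\<omega>. X \<omega> \<le> b"
  shows "variance X \<le> (b - expectation X) * expectation X"
proof -
  have sq_le: "(X \<omega>)\<^sup>2 \<le> b * X \<omega>" for \<omega>
    using bounds[of \<omega>] by (simp add: power2_eq_square mult_right_mono)
  have int: "integrable M X"
    using bounds by (intro integrable_const_bound[where B=b]) auto
  have int2: "integrable M (\<lambda>\<omega>. (X \<omega>)\<^sup>2)"
  proof (rule Bochner_Integration.integrable_bound)
    show "integrable M (\<lambda>\<omega>. b * X \<omega>)"
      using int by simp
    show "AE \<omega> in M. norm ((X \<omega>)\<^sup>2) \<le> norm (b * X \<omega>)"
      using order_trans[OF sq_le abs_ge_self] by simp
  qed simp
  have "expectation (\<lambda>\<omega>. (X \<omega>)\<^sup>2) \<le> expectation (\<lambda>\<omega>. b * X \<omega>)"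
    using int int2 sq_le by (intro integral_mono) auto
  then show ?thesis
    unfolding variance_eq[OF int int2]
    by (simp add: power2_eq_square[of "expectation X"] left_diff_distrib)
qed

lemma square_integrable_imp_integrable_prod:
  fixes X Y :: "'a \<Rightarrow> real"
  assumes [measurable]: "X \<in> borel_measurable M" "Y \<in> borel_measurable M"
    and "integrable M (\<lambda>\<omega>. (X \<omega>)\<^sup>2)" "integrable M (\<lambda>\<omega>. (Y \<omega>)\<^sup>2)"
  shows "integrable M (\<lambda>\<omega>. X \<omega> * Y \<omega>)"
proof (rule Bochner_Integration.integrable_bound)
  show "integrable M (\<lambda>\<omega>. (X \<omega>)\<^sup>2 + (Y \<omega>)\<^sup>2)"
    using assms by simp
  have "\<bar>x * y\<bar> \<le> x\<^sup>2 + y\<^sup>2" for x y :: real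
    using sum_squares_bound[of "\<bar>x\<bar>" "\<bar>y\<bar>"] mult_nonneg_nonneg[of "\<bar>x\<bar>" "\<bar>y\<bar>"]
    unfolding abs_mult power2_abs by linarith
  then show "AE \<omega> in M. norm (X \<omega> * Y \<omega>) \<le> norm ((X \<omega>)\<^sup>2 + (Y \<omega>)\<^sup>2)"
    by simp
qed simp

text \<open>
  The last summand is twice the covariance of the truncated part and the overshoot, which is
  explicit because the truncated part is constantly \<open>b\<close> wherever the overshoot is nonzero.
\<close>

lemma variance_truncation:
  fixes Y :: "'a \<Rightarrow> real" and b :: real
  defines "X \<equiv> \<lambda>\<omega>. min (Y \<omega>) b"
  defines "Z \<equiv> \<lambda>\<omega>. Y \<omega> - X \<omega>"
  assumes int: "integrable M Y" "integrable M (\<lambda>\<omega>. (Y \<omega>)\<^sup>2)"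
  shows "variance Y = variance X + variance Z + 2 * (b - expectation X) * expectation Z"
proof -
  have [measurable]: "Y \<in> borel_measurable M"
    using int(1) by simp
  have [measurable]: "X \<in> borel_measurable M" "Z \<in> borel_measurable M"
    unfolding X_def Z_def by measurable
  have XI: "integrable M X"
    unfolding X_def using int(1) by simp
  have ZI: "integrable M Z"
    unfolding Z_def using int(1) XI by simp
  have X2: "integrable M (\<lambda>\<omega>. (X \<omega>)\<^sup>2)"
  proof (rule Bochner_Integration.integrable_bound)
    show "integrable M (\<lambda>\<omega>. (Y \<omega>)\<^sup>2 + b\<^sup>2)"
      using int(2) by simp
    show "AE \<omega> in M. norm ((X \<omega>)\<^sup>2) \<le> norm ((Y \<omega>)\<^sup>2 + b\<^sup>2)"
      by (simp add: X_def min_def)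
  qed simp
  have XY: "integrable M (\<lambda>\<omega>. X \<omega> * Y \<omega>)"
    using int X2 by (intro square_integrable_imp_integrable_prod) auto
  have "integrable M (\<lambda>\<omega>. (Y \<omega>)\<^sup>2 - 2 * (X \<omega> * Y \<omega>) + (X \<omega>)\<^sup>2)"
    using int(2) XY X2 by simp
  then have Z2: "integrable M (\<lambda>\<omega>. (Z \<omega>)\<^sup>2)"
    by (simp add: Z_def power2_eq_square algebra_simps)
  have EY: "expectation Y = expectation X + expectation Z"
    unfolding Z_def using int(1) XI by simp
  \<comment> \<open>The mixed term is \<open>2 * X * Z = 2 * b * Z\<close>, since \<open>X = b\<close> wherever \<open>Z\<close> is nonzero.\<close>
  have split: "(Y \<omega>)\<^sup>2 = (X \<omega>)\<^sup>2 + (Z \<omega>)\<^sup>2 + 2 * b * Z \<omega>" for \<omega>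
    by (simp add: X_def Z_def min_def power2_eq_square algebra_simps)
  have "expectation (\<lambda>\<omega>. (Y \<omega>)\<^sup>2)
      = expectation (\<lambda>\<omega>. (X \<omega>)\<^sup>2) + expectation (\<lambda>\<omega>. (Z \<omega>)\<^sup>2) + 2 * b * expectation Z"
    unfolding split using X2 Z2 ZI by simp
  then show ?thesis
    unfolding variance_eq[OF int] variance_eq[OF XI X2] variance_eq[OF ZI Z2]
    by (simp add: EY power2_sum algebra_simps)
qed

text \<open>
  The case distinction is on the mean shortfall \<open>a\<close>.  The threshold 1 is at most \<open>b\<close>, so \<open>a < 1\<close> makes
  the mean of the truncated variable positive; and it exceeds \<open>1 / 2\<close>, so \<open>a \<ge> 1\<close> makes twice the
  covariance outweigh the mean of the overshoot.
\<close>

theorem variance_less_expectation_truncation: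
  fixes Y :: "'a \<Rightarrow> real"
  assumes int: "integrable M Y" "integrable M (\<lambda>\<omega>. (Y \<omega>)\<^sup>2)"
    and nonneg: "\<And>\<omega>. 0 \<le> Y \<omega>" and b: "1 \<le> b"
    and le: "variance Y \<le> expectation Y"
    and strict: "variance Y < expectation Y \<or> 0 < expectation (\<lambda>\<omega>. Y \<omega> - min (Y \<omega>) b)"
  shows "variance (\<lambda>\<omega>. min (Y \<omega>) b) < expectation (\<lambda>\<omega>. min (Y \<omega>) b)"
proof -
  define X where "X = (\<lambda>\<omega>. min (Y \<omega>) b)"
  define Z where "Z = (\<lambda>\<omega>. Y \<omega> - X \<omega>)"
  define a where "a = b - expectation X"
  have XI: "integrable M X"
    unfolding X_def using int(1) by simp
  have "variance X < expectation X"
  proof (cases "a < 1")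
    case True
    have "variance X \<le> a * expectation X"
      unfolding a_def using XI nonneg b
      by (intro variance_le_bounded) (auto simp: X_def)
    also have "\<dots> < expectation X"
      using True b by (simp add: a_def)
    finally show ?thesis .
  next
    case False
    have EZ: "expectation Z = expectation Y - expectation X"
      unfolding Z_def using int(1) XI by simp
    have Z_nonneg: "0 \<le> expectation Z"
      by (intro integral_nonneg_AE) (simp add: Z_def X_def)
    have "expectation Z \<le> a * expectation Z"
      using False Z_nonneg by (simp add: mult_le_cancel_right1)
    moreover have "variance Y = variance X + variance Z + 2 * a * expectation Z"
      unfolding a_def Z_def X_def by (rule variance_truncation[OF int])
    moreover have "0 \<le> variance Z"
      by (rule variance_positive)
    ultimately have "variance X - expectation X + expectation Z \<le> variance Y - expectation Y"
      using EZ by linarith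
    moreover have "variance Y < expectation Y \<or> 0 < expectation Z"
      using strict by (simp add: Z_def X_def)
    ultimately show ?thesis
      using le Z_nonneg by linarith
  qed
  then show ?thesis
    by (simp add: X_def)
qed

end

section \<open>Moments of the Poisson distribution\<close>

lemma has_bochner_integral_nat_pmf_iff:
  fixes p :: "nat pmf" and f :: "nat \<Rightarrow> real"
  assumes nonneg: "\<And>n. 0 \<le> f n"
  shows "has_bochner_integral (measure_pmf p) f x \<longleftrightarrow> (\<lambda>n. pmf p n * f n) sums x"
proof -
  have "has_bochner_integral (measure_pmf p) f x
      \<longleftrightarrow> has_bochner_integral (count_space UNIV) (\<lambda>n. pmf p n * f n) x"
    by (simp add: measure_pmf_eq_density has_bochner_integral_iff
        integral_real_density integrable_real_density)
  also have "\<dots> \<longleftrightarrow> (\<lambda>n. pmf p n * f n) sums x"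
    using nonneg
    by (auto simp: has_bochner_integral_iff integrable_count_space_nat_iff sums_iff
        integral_count_space_nat)
  finally show ?thesis .
qed

text \<open>
  This is the Stein--Chen identity.  It holds because the weights satisfy
  \<open>(n + 1) * p (n + 1) = rate * p n\<close>, and the summand at \<open>0\<close> vanishes.
\<close>

lemma has_bochner_integral_poisson_Suc:
  fixes g :: "nat \<Rightarrow> real"
  assumes rate: "0 < rate" and nonneg: "\<And>n. 0 \<le> g n"
    and g: "has_bochner_integral (measure_pmf (poisson_pmf rate)) (\<lambda>n. g (Suc n)) x"
  shows "has_bochner_integral (measure_pmf (poisson_pmf rate)) (\<lambda>n. real n * g n) (rate * x)"
proof -
  let ?p = "pmf (poisson_pmf rate)"
  have shift: "?p (Suc n) * (real (Suc n) * g (Suc n)) = rate * (?p n * g (Suc n))" for n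
    using rate by (simp add: divide_simps)
  have "(\<lambda>n. ?p n * g (Suc n)) sums x"
    using g nonneg by (simp only: has_bochner_integral_nat_pmf_iff)
  then have "(\<lambda>n. ?p (Suc n) * (real (Suc n) * g (Suc n))) sums (rate * x)"
    unfolding shift by (rule sums_mult)
  then have "(\<lambda>n. ?p n * (real n * g n)) sums (rate * x)"
    by (subst (asm) sums_Suc_iff) simp
  then show ?thesis
    using nonneg by (subst has_bochner_integral_nat_pmf_iff) auto
qed

lemma
  assumes "0 < rate"
  shows has_bochner_integral_poisson:
      "has_bochner_integral (measure_pmf (poisson_pmf rate)) real rate"
    and has_bochner_integral_poisson_square:
      "has_bochner_integral (measure_pmf (poisson_pmf rate)) (\<lambda>n. (real n)\<^sup>2) (rate * (rate + 1))"
proof -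
  let ?P = "measure_pmf (poisson_pmf rate)"
  have one: "has_bochner_integral ?P (\<lambda>n. 1) (1::real)"
    by (simp add: has_bochner_integral_iff)
  show mean: "has_bochner_integral ?P real rate"
    using has_bochner_integral_poisson_Suc[OF assms, of "\<lambda>n. 1" 1] one by simp
  have "has_bochner_integral ?P (\<lambda>n. real (Suc n)) (rate + 1)"
    using has_bochner_integral_add[OF mean one] by (simp add: add.commute)
  then show "has_bochner_integral ?P (\<lambda>n. (real n)\<^sup>2) (rate * (rate + 1))"
    using has_bochner_integral_poisson_Suc[OF assms, of real "rate + 1"]
    by (simp add: power2_eq_square)
qed

section \<open>Truncated counting variables\<close>

context prob_space
begin

lemma var_trunc_rv_less:
  assumes Y [measurable]: "Y \<in> measurable M (count_space UNIV)"
    and int: "integrable M (\<lambda>\<omega>. real (Y \<omega>))" "integrable M (\<lambda>\<omega>. (real (Y \<omega>))\<^sup>2)"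
    and le: "var M Y \<le> expect M Y" and N: "0 < N"
    and strict: "var M Y < expect M Y \<or> 0 < prob {\<omega> \<in> space M. N < Y \<omega>}"
  shows "var M (trunc_rv Y N) < expect M (trunc_rv Y N)"
proof -
  let ?Z = "\<lambda>\<omega>. real (Y \<omega>) - min (real (Y \<omega>)) (real N)"
  \<comment> \<open>An integer that exceeds \<open>N\<close> exceeds it by at least 1.\<close>
  have "prob {\<omega> \<in> space M. N < Y \<omega>} = expectation (indicator {\<omega> \<in> space M. N < Y \<omega>})"
    by simp
  also have "\<dots> \<le> expectation ?Z"
  proof (rule integral_mono)
    show "integrable M (indicator {\<omega> \<in> space M. N < Y \<omega>} :: _ \<Rightarrow> real)"
      by (simp add: emeasure_eq_measure)
    show "integrable M ?Z"
      using int(1) by simp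
    show "indicator {\<omega> \<in> space M. N < Y \<omega>} \<omega> \<le> ?Z \<omega>" for \<omega>
      by (auto simp: indicator_def min_def)
  qed
  finally have "prob {\<omega> \<in> space M. N < Y \<omega>} \<le> expectation ?Z" .
  then have "variance (\<lambda>\<omega>. min (real (Y \<omega>)) (real N)) < expectation (\<lambda>\<omega>. min (real (Y \<omega>)) (real N))"
    using int le N strict
    by (intro variance_less_expectation_truncation) (auto simp: var_def expect_def)
  then show ?thesis
    by (simp add: var_def expect_def trunc_rv_def of_nat_min)
qed

lemma poisson_moments_and_tail:
  assumes Y [measurable]: "Y \<in> measurable M (count_space UNIV)"
    and rate: "0 < rate"
    and distr: "distr M (count_space UNIV) Y = measure_pmf (poisson_pmf rate)"
  shows "integrable M (\<lambda>\<omega>. real (Y \<omega>))" "integrable M (\<lambda>\<omega>. (real (Y \<omega>))\<^sup>2)"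
    and "var M Y = expect M Y" and "0 < prob {\<omega> \<in> space M. N < Y \<omega>}"
proof -
  have transfer: "has_bochner_integral M (\<lambda>\<omega>. f (Y \<omega>)) x"
    if "has_bochner_integral (measure_pmf (poisson_pmf rate)) f x" for f :: "nat \<Rightarrow> real" and x
  proof -
    have "has_bochner_integral (distr M (count_space UNIV) Y) f x"
      using that by (simp only: distr)
    then show ?thesis
      by (simp add: has_bochner_integral_iff integrable_distr_eq[OF Y] integral_distr[OF Y])
  qed
  have m1: "has_bochner_integral M (\<lambda>\<omega>. real (Y \<omega>)) rate"
    by (rule transfer[OF has_bochner_integral_poisson[OF rate]])
  have m2: "has_bochner_integral M (\<lambda>\<omega>. (real (Y \<omega>))\<^sup>2) (rate * (rate + 1))"
    by (rule transfer[OF has_bochner_integral_poisson_square[OF rate]])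
  show int: "integrable M (\<lambda>\<omega>. real (Y \<omega>))" "integrable M (\<lambda>\<omega>. (real (Y \<omega>))\<^sup>2)"
    using m1 m2 by (auto simp: has_bochner_integral_iff)
  show "var M Y = expect M Y"
    using m1 m2 unfolding var_def expect_def variance_eq[OF int]
    by (simp add: has_bochner_integral_iff power2_eq_square algebra_simps)
  have "prob {\<omega> \<in> space M. N < Y \<omega>} = measure (distr M (count_space UNIV) Y) {N<..}"
    by (simp add: measure_distr[OF Y] vimage_def Int_def conj_commute)
  also have "\<dots> > 0"
    unfolding distr using rate by (intro measure_pmf_posI[where x="Suc N"]) auto
  finally show "0 < prob {\<omega> \<in> space M. N < Y \<omega>}" .
qed

end

theorem lemma4p2:
  fixes M :: "'a measure" and Y :: "'a \<Rightarrow> nat"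
  assumes "prob_space M"
    and "Y \<in> measurable M (count_space UNIV)"
  shows "(integrable M (\<lambda>\<omega>. real (Y \<omega>)) \<and> integrable M (\<lambda>\<omega>. (real (Y \<omega>))\<^sup>2) \<and>
            var M Y \<le> expect M Y
          \<longrightarrow> (\<forall>N::nat. N > 0 \<and>
                 (var M Y < expect M Y \<or> measure M {\<omega> \<in> space M. Y \<omega> > N} > 0)
               \<longrightarrow> var M (trunc_rv Y N) < expect M (trunc_rv Y N)))
       \<and> ((\<exists>rate::real. rate > 0 \<and>
              distr M (count_space UNIV) Y = measure_pmf (poisson_pmf rate))
          \<longrightarrow> (\<forall>N::nat. N > 0 \<longrightarrow> var M (trunc_rv Y N) < expect M (trunc_rv Y N)))"
proof -
  interpret prob_space M
    by fact
  note Y = assms(2)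
  have "var M (trunc_rv Y N) < expect M (trunc_rv Y N)"
    if "0 < rate" "distr M (count_space UNIV) Y = measure_pmf (poisson_pmf rate)" "0 < N"
    for rate N
    using poisson_moments_and_tail[OF Y that(1,2)] that(3) by (intro var_trunc_rv_less[OF Y]) auto
  then show ?thesis
    using var_trunc_rv_less[OF Y] by blast
qed

end
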